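(* (Soundness.) If $N$ is a $\beta$-normal form and $\mathtt{Infer}(N)=(\Gamma,\sigma)$, then $\Gamma\vdash_{SM_r}N:\sigma$.
   Context: Terms (de Bruijn): $M,N::=\underline{n}\mid (M\,N)\mid\lambda.M$, $n\in\mathbb{N}^*$; application associates to the left. A $\beta$-normal form is a term with no subterm of the form $((\lambda.M)\,N)$; these are exactly the terms $\underline{n}$, $\lambda.N'$ with $N'$ a $\beta$-normal form, and $\underline{n}\,N_1\cdots N_m$ with each $N_j$ a $\beta$-normal form. Types: $\mathcal{A}$ is a denumerable set of type variables; $\tau,\sigma\in\mathcal{T}::=\alpha\mid u\to\tau$ and $u\in\mathcal{U}::=\omega\mid u\wedge u\mid\tau$, with $\wedge$ commutative, associative and with neutral element $\omega$; $\to$ associates to the right. Contexts: $\Gamma::=nil\mid u.\Gamma$; $\Gamma_i$ is the $i$-th element, $|\Gamma|$ the length; $\omega^{k}.\Gamma$ is $\Gamma$ prefixed by $k$ copies of $\omega$. Intersection of contexts: $nil\wedge\Gamma=\Gamma\wedge nil=\Gamma$, $(u_1.\Gamma)\wedge(u_2.\Delta)=(u_1\wedge u_2).(\Gamma\wedge\Delta)$. System $SM_r$ derives judgements $\Gamma\vdash M:\tau$ by: (var$_r$) $(\sigma_1\to\cdots\to\sigma_n\to\alpha).nil\vdash\underline{1}:\sigma_1\to\cdots\to\sigma_n\to\alpha$ ($n\ge0$, $\sigma_i\in\mathcal{T}$, $\alpha\in\mathcal{A}$); (varn) from $\Gamma\vdash\underline{n}:\tau$ infer $\omega.\Gamma\vdash\underline{n+1}:\tau$;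 ($\to_i$) from $u.\Gamma\vdash M:\tau$ infer $\Gamma\vdash\lambda.M:u\to\tau$; ($\to_i'$) from $nil\vdash M:\tau$ infer $nil\vdash\lambda.M:\omega\to\tau$; ($\to_e'$) from $\Gamma\vdash M_1:\omega\to\tau$ and $\Delta\vdash M_2:\sigma$ infer $\Gamma\wedge\Delta\vdash(M_1\,M_2):\tau$; ($\to_e$) from $\Gamma\vdash M_1:(\sigma_1\wedge\cdots\wedge\sigma_n)\to\tau$ ($n\ge1$) and $\Delta^i\vdash M_2:\sigma_i$ for all $i$ infer $\Gamma\wedge\Delta^1\wedge\cdots\wedge\Delta^n\vdash(M_1\,M_2):\tau$. The algorithm $\mathtt{Infer}$ on $\beta$-normal forms: $\mathtt{Infer}(\underline{n})=(\omega^{n-1}.\alpha.nil,\alpha)$ with $\alpha$ fresh; $\mathtt{Infer}(\lambda.N')$: let $(\Gamma',\sigma)=\mathtt{Infer}(N')$; if $\Gamma'=u.\Gamma$ return $(\Gamma,u\to\sigma)$, otherwise ($\Gamma'=nil$) return $(nil,\omega\to\sigma)$; $\mathtt{Infer}(\underline{n}\,N_1\cdots N_m)$ ($m\ge1$): let $(\Gamma^i,\sigma_i)=\mathtt{Infer}(N_i)$ for $1\le i\le m$ and $\alpha$ fresh; return $((\omega^{n-1}.(\sigma_1\to\cdots\to\sigma_m\to\alpha).nil)\wedge\Gamma^1\wedge\cdots\wedge\Gamma^m,\ \alpha)$. "Fresh" means a type variable never chosen before, so distinct calls produce disjoint sets of type variables; $\mathtt{Infer}$ is defined up to renaming of type variables.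 *)

theory Defs
  imports Main "HOL-Library.Multiset"
begin

text \<open>De Bruijn indices start at 1, so \<open>Var 0\<close> is not a term of the calculus; \<open>is_term\<close>
  singles out the genuine terms.\<close>

datatype dterm = Var nat | App dterm dterm | Lam dterm

primrec is_term :: "dterm \<Rightarrow> bool" where
  "is_term (Var n) \<longleftrightarrow> n \<ge> 1"
| "is_term (App M N) \<longleftrightarrow> is_term M \<and> is_term N"
| "is_term (Lam M) \<longleftrightarrow> is_term M"

primrec subterms :: "dterm \<Rightarrow> dterm set" where
  "subterms (Var n) = {Var n}"
| "subterms (App M N) = insert (App M N) (subterms M \<union> subterms N)"
| "subterms (Lam M) = insert (Lam M) (subterms M)"

definition beta_nf :: "dterm \<Rightarrow> bool" where
  "beta_nf M \<longleftrightarrow> \<not> (\<exists>P Q. App (Lam P) Q \<in> subterms M)"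

text \<open>Intersection types are generated from types by a binary operation that is commutative,
  associative (but not idempotent) and has the neutral element \<open>\<omega>\<close>: they form the free
  commutative monoid over types, that is, finite multisets of types, with \<open>\<omega> = {#}\<close>,
  intersection \<open>(+)\<close>, and a type \<open>\<tau>\<close> regarded as the intersection \<open>{#\<tau>#}\<close>.\<close>

type_synonym tvar = nat

datatype ty = TVar tvar | Arr "ty multiset" ty  (infixr "\<rightarrow>" 60)

type_synonym ity = "ty multiset"

abbreviation omega :: ity  ("\<omega>") where
  "\<omega> \<equiv> {#}"

text \<open>\<open>arrows [\<sigma>\<^sub>1, \<dots>, \<sigma>\<^sub>n] \<tau>\<close> is \<open>\<sigma>\<^sub>1 \<rightarrow> \<cdots> \<rightarrow> \<sigma>\<^sub>n \<rightarrow> \<tau>\<close>.\<close>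

definition arrows :: "ty list \<Rightarrow> ty \<Rightarrow> ty" where
  "arrows \<sigma>s \<tau> = foldr (\<lambda>\<sigma> \<rho>. {#\<sigma>#} \<rightarrow> \<rho>) \<sigma>s \<tau>"

type_synonym ctx = "ity list"

fun cinter :: "ctx \<Rightarrow> ctx \<Rightarrow> ctx"  (infixl "\<sqinter>" 70) where
  "[] \<sqinter> \<Gamma> = \<Gamma>"
| "\<Gamma> \<sqinter> [] = \<Gamma>"
| "(u # \<Gamma>) \<sqinter> (v # \<Delta>) = (u + v) # (\<Gamma> \<sqinter> \<Delta>)"

text \<open>\<open>cinters \<Gamma> [\<Delta>\<^sub>1, \<dots>, \<Delta>\<^sub>n]\<close> is \<open>\<Gamma> \<sqinter> \<Delta>\<^sub>1 \<sqinter> \<cdots> \<sqinter> \<Delta>\<^sub>n\<close>.\<close>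

abbreviation cinters :: "ctx \<Rightarrow> ctx list \<Rightarrow> ctx" where
  "cinters \<Gamma> \<Delta>s \<equiv> foldl (\<sqinter>) \<Gamma> \<Delta>s"

inductive typing_SMr :: "ctx \<Rightarrow> dterm \<Rightarrow> ty \<Rightarrow> bool"  ("_ \<turnstile>\<^sub>r _ \<Colon> _" [50, 50, 50] 50) where
  var_r: "[{#arrows \<sigma>s (TVar \<alpha>)#}] \<turnstile>\<^sub>r Var 1 \<Colon> arrows \<sigma>s (TVar \<alpha>)"
| var_n: "\<Gamma> \<turnstile>\<^sub>r Var n \<Colon> \<tau> \<Longrightarrow> \<omega> # \<Gamma> \<turnstile>\<^sub>r Var (n + 1) \<Colon> \<tau>"
| arr_i: "u # \<Gamma> \<turnstile>\<^sub>r M \<Colon> \<tau> \<Longrightarrow> \<Gamma> \<turnstile>\<^sub>r Lam M \<Colon> u \<rightarrow> \<tau>"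
| arr_i': "[] \<turnstile>\<^sub>r M \<Colon> \<tau> \<Longrightarrow> [] \<turnstile>\<^sub>r Lam M \<Colon> \<omega> \<rightarrow> \<tau>"
| arr_e': "\<lbrakk>\<Gamma> \<turnstile>\<^sub>r M\<^sub>1 \<Colon> \<omega> \<rightarrow> \<tau>; \<Delta> \<turnstile>\<^sub>r M\<^sub>2 \<Colon> \<sigma>\<rbrakk> \<Longrightarrow> \<Gamma> \<sqinter> \<Delta> \<turnstile>\<^sub>r App M\<^sub>1 M\<^sub>2 \<Colon> \<tau>"
| arr_e: "\<lbrakk>\<Gamma> \<turnstile>\<^sub>r M\<^sub>1 \<Colon> mset \<sigma>s \<rightarrow> \<tau>; \<sigma>s \<noteq> []; length \<Delta>s = length \<sigma>s;
           \<And>i. i < length \<sigma>s \<Longrightarrow> \<Delta>s ! i \<turnstile>\<^sub>r M\<^sub>2 \<Colon> \<sigma>s ! i\<rbrakk>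
          \<Longrightarrow> cinters \<Gamma> \<Delta>s \<turnstile>\<^sub>r App M\<^sub>1 M\<^sub>2 \<Colon> \<tau>"

text \<open>The algorithm is a relation because the choice of fresh type variables is left open.
  In \<open>infer_run V N \<Gamma> \<sigma> V'\<close> the set \<open>V\<close> collects the type variables chosen before the call on
  \<open>N\<close>, the set \<open>V'\<close> those chosen up to its end, and the call returns \<open>(\<Gamma>, \<sigma>)\<close>; a fresh type
  variable is any one not chosen before. \<open>infer_args\<close> runs the algorithm
  on the successive elements of a list of terms.\<close>

inductive
  infer_run :: "tvar set \<Rightarrow> dterm \<Rightarrow> ctx \<Rightarrow> ty \<Rightarrow> tvar set \<Rightarrow> bool" and
  infer_args :: "tvar set \<Rightarrow> dterm list \<Rightarrow> (ctx \<times> ty) list \<Rightarrow> tvar set \<Rightarrow> bool"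
where
  infer_var: "\<lbrakk>n \<ge> 1; \<alpha> \<notin> V\<rbrakk>
    \<Longrightarrow> infer_run V (Var n) (replicate (n - 1) \<omega> @ [{#TVar \<alpha>#}]) (TVar \<alpha>) (insert \<alpha> V)"
| infer_lam: "infer_run V N (u # \<Gamma>) \<sigma> V' \<Longrightarrow> infer_run V (Lam N) \<Gamma> (u \<rightarrow> \<sigma>) V'"
| infer_lam_nil: "infer_run V N [] \<sigma> V' \<Longrightarrow> infer_run V (Lam N) [] (\<omega> \<rightarrow> \<sigma>) V'"
| infer_app: "\<lbrakk>n \<ge> 1; Ns \<noteq> []; infer_args V Ns rs V'; \<alpha> \<notin> V'\<rbrakk>
    \<Longrightarrow> infer_run V (foldl App (Var n) Ns)
          (cinters (replicate (n - 1) \<omega> @ [{#arrows (map snd rs) (TVar \<alpha>)#}]) (map fst rs))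
          (TVar \<alpha>) (insert \<alpha> V')"
| infer_args_Nil: "infer_args V [] [] V"
| infer_args_Cons: "\<lbrakk>infer_run V N \<Gamma> \<sigma> V'; infer_args V' Ns rs V''\<rbrakk>
    \<Longrightarrow> infer_args V (N # Ns) ((\<Gamma>, \<sigma>) # rs) V''"

text \<open>\<open>Infer N (\<Gamma>, \<sigma>)\<close>: the algorithm, started on \<open>N\<close> with no type variable chosen yet, can
  return \<open>(\<Gamma>, \<sigma>)\<close>.\<close>

definition Infer :: "dterm \<Rightarrow> ctx \<times> ty \<Rightarrow> bool" where
  "Infer N r \<longleftrightarrow> (\<exists>V'. infer_run {} N (fst r) (snd r) V')"

end

theory Submission imports Defs begin

text \<open>Each clause of the algorithm is the trace of a derivation, so induction on the run
  rebuilds it. Abstractions use \<open>arr_i\<close> or \<open>arr_i'\<close>, according to the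
  shape of the context. For a variable applied to arguments, the head receives exactly the arrow
  type built from the inferred argument types (\<open>typing_Var\<close>); each domain is a single
  type, so \<open>arr_e\<close> with one premise consumes each argument in turn
  (\<open>typing_foldl_App\<close>).\<close>

lemma typing_Var:
  assumes "n \<ge> 1"
  shows "replicate (n - 1) \<omega> @ [{#arrows \<sigma>s (TVar \<alpha>)#}] \<turnstile>\<^sub>r Var n \<Colon> arrows \<sigma>s (TVar \<alpha>)"
  using assms
proof (induction n rule: dec_induct)
  case base
  show ?case using var_r by simp
next
  case (step n)
  \<comment> \<open>As n \<ge> 1, the truncated n - 1 really grows by one, matching the
    \<open>\<omega>\<close> that \<open>var_n\<close> prepends.\<close>
  then show ?case using var_n[OF step.IH] by (cases n) simp_all
qed

text \<open>The head is arbitrary, not a variable: after the first argument, the application itself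
  is the head for the remaining ones.\<close>

lemma typing_foldl_App:
  assumes "list_all2 (\<lambda>N r. fst r \<turnstile>\<^sub>r N \<Colon> snd r) Ns rs"
    and "\<Gamma> \<turnstile>\<^sub>r M \<Colon> arrows (map snd rs) \<tau>"
  shows "cinters \<Gamma> (map fst rs) \<turnstile>\<^sub>r foldl App M Ns \<Colon> \<tau>"
  using assms
proof (induction arbitrary: \<Gamma> M rule: list_all2_induct)
  case Nil
  then show ?case by (simp add: arrows_def)
next
  case (Cons N Ns r rs)
  \<comment> \<open>The first domain is written as \<open>mset\<close> of a one-element list to fit
    \<open>arr_e\<close>.\<close>
  have "\<Gamma> \<turnstile>\<^sub>r M \<Colon> mset [snd r] \<rightarrow> arrows (map snd rs) \<tau>"
    using Cons.prems by (simp add: arrows_def)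
  then have "cinters \<Gamma> [fst r] \<turnstile>\<^sub>r App M N \<Colon> arrows (map snd rs) \<tau>"
    using Cons.hyps by (intro arr_e) auto
  then show ?case using Cons.IH by simp
qed

lemma infer_sound:
  "infer_run V N \<Gamma> \<sigma> V' \<Longrightarrow> \<Gamma> \<turnstile>\<^sub>r N \<Colon> \<sigma>"
  "infer_args V Ns rs V' \<Longrightarrow> list_all2 (\<lambda>N r. fst r \<turnstile>\<^sub>r N \<Colon> snd r) Ns rs"
proof (induction rule: infer_run_infer_args.inducts)
  case (infer_var n \<alpha> V)
  \<comment> \<open>A bare type variable is the arrow type with no arguments.\<close>
  then show ?case using typing_Var[of n "[]" \<alpha>] by (simp add: arrows_def)
next
  case (infer_app n Ns V rs V' \<alpha>)
  then show ?case by (intro typing_foldl_App typing_Var)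
qed (auto intro: arr_i arr_i')

theorem theorem2p9:
  fixes N :: dterm and \<Gamma> :: ctx and \<sigma> :: ty
  assumes "is_term N" and "beta_nf N" and "Infer N (\<Gamma>, \<sigma>)"
  shows "\<Gamma> \<turnstile>\<^sub>r N \<Colon> \<sigma>"
  using assms(3) infer_sound(1) by (auto simp: Infer_def)

end
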